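(* Fix an integer $m\geq 0$. For integers $n\geq m$ and $0\leq k\leq n-m$ let $$NA_{\langle m\rangle}(n,k)=\frac{m+1}{n+2}\binom{n+2}{k+1}\binom{n-m}{k}.$$ Then the infinite matrix $$N_{A,\langle m\rangle}^{\square}=\left[NA_{\langle m\rangle}(n+k,k)\right]_{n\geq m,\ k\geq 0}$$ (rows indexed by $n\ge m$, columns by $k\ge 0$) is strictly totally positive.
   Context: A (finite or infinite) real matrix is strictly totally positive (STP) if all of its minors are positive. *)

theory Defs
  imports Complex_Main "Jordan_Normal_Form.Determinant"
begin

text \<open>
  A (possibly infinite) matrix with rows indexed by \<open>I\<close> and columns indexed by \<open>J\<close> is a
  function \<open>A\<close> of which only the entries \<open>A i j\<close> with \<open>i \<in> I\<close> and \<open>j \<in> J\<close> matter. The functions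
  \<open>rs\<close> and \<open>cs\<close> list, in increasing order, the rows and columns selected for an \<open>r \<times> r\<close> minor;
  only their values on \<open>{..<r}\<close> matter.
\<close>

definition minor ::
  "('i \<Rightarrow> 'j \<Rightarrow> real) \<Rightarrow> nat \<Rightarrow> (nat \<Rightarrow> 'i) \<Rightarrow> (nat \<Rightarrow> 'j) \<Rightarrow> real" where
  "minor A r rs cs = det (mat r r (\<lambda>(a, b). A (rs a) (cs b)))"

definition strictly_totally_positive ::
  "'i::linorder set \<Rightarrow> 'j::linorder set \<Rightarrow> ('i \<Rightarrow> 'j \<Rightarrow> real) \<Rightarrow> bool" where
  "strictly_totally_positive I J A \<longleftrightarrow>
     (\<forall>r rs cs. r \<ge> 1 \<longrightarrow>
        strict_mono_on {..<r} rs \<longrightarrow> rs ` {..<r} \<subseteq> I \<longrightarrow>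
        strict_mono_on {..<r} cs \<longrightarrow> cs ` {..<r} \<subseteq> J \<longrightarrow>
        minor A r rs cs > 0)"

text \<open>
  Meaningful for \<open>n \<ge> m\<close> and \<open>k \<le> n - m\<close>, where the subtraction on \<^typ>\<open>nat\<close> does not truncate.
\<close>

definition NA :: "nat \<Rightarrow> nat \<Rightarrow> nat \<Rightarrow> real" where
  "NA m n k = real (m + 1) / real (n + 2) * real ((n + 2) choose (k + 1)) * real ((n - m) choose k)"

end

theory Submission
  imports Defs
begin

text \<open>
  Up to positive row and column factors, the entry in row \<open>m + p\<close> and column \<open>k\<close> is
  \<open>(p + k)! (p + k + m + 1)!\<close>, so the matrix is a rescaled Hankel matrix. The Vandermonde
  convolution writes \<open>[(s + i + j)!]\<close> as a Gram matrix \<open>U W U\<^sup>T\<close> with \<open>W\<close> positive diagonal and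
  \<open>U\<close> lower triangular; the entrywise product of two such matrices is positive definite, so
  contiguous minors are positive. By a criterion of Fekete, this suffices: dividing by the first
  column and taking successive differences of rows lowers the order by one, and a difference of
  two distant rows telescopes, so that by multilinearity a minor with arbitrary rows is a sum of
  smaller minors with increasing rows.
\<close>

section \<open>Elementary identities for minors and determinants\<close>

lemma minor_transpose: "minor (\<lambda>i j. A j i) r cs rs = minor A r rs cs"
proof -
  have "mat r r (\<lambda>(a, b). A (rs b) (cs a)) = transpose_mat (mat r r (\<lambda>(a, b). A (rs a) (cs b)))"
    by (intro eq_matI) auto
  then show ?thesis
    unfolding minor_def by (metis det_transpose mat_carrier)
qed

lemma det_mat_leibniz:
  "det (mat n n (\<lambda>(i, j). f i j)) =
     (\<Sum>p | p permutes {0..<n}. signof p * (\<Prod>i = 0..<n. f i (p i)))"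
  unfolding det_def by (auto simp: permutes_in_image intro!: sum.cong prod.cong)

text \<open>Every Leibniz term meets each row and each column exactly once, so the scaling factors
  leave the sum.\<close>

lemma minor_scale:
  "minor (\<lambda>i j. x i * y j * A i j) r rs cs =
     (\<Prod>a<r. x (rs a)) * (\<Prod>b<r. y (cs b)) * minor A r rs cs"
proof -
  have "(\<Prod>i = 0..<r. x (rs i) * y (cs (p i)) * A (rs i) (cs (p i))) =
      (\<Prod>a<r. x (rs a)) * (\<Prod>b<r. y (cs b)) * (\<Prod>i = 0..<r. A (rs i) (cs (p i)))"
    if "p permutes {0..<r}" for p
    using prod.permute[OF that, of "\<lambda>i. y (cs i)"]
    by (simp add: prod.distrib lessThan_atLeast0 o_def)
  then show ?thesis
    unfolding minor_def det_mat_leibniz sum_distrib_left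
    by (intro sum.cong) (auto simp: mult_ac)
qed

text \<open>Multilinearity in the rows: expanding all of them at once gives one determinant for each
  choice function.\<close>

lemma det_sum_rows:
  fixes g :: "'b \<Rightarrow> nat \<Rightarrow> 'a::comm_ring_1"
  assumes "\<And>b. b < r \<Longrightarrow> finite (S b)"
  shows "det (mat r r (\<lambda>(b, a). \<Sum>i\<in>S b. g i a)) =
    (\<Sum>\<phi>\<in>PiE {..<r} S. det (mat r r (\<lambda>(b, a). g (\<phi> b) a)))"
proof -
  have "(\<Prod>b = 0..<r. \<Sum>i\<in>S b. g i (p b)) = (\<Sum>\<phi>\<in>PiE {..<r} S. \<Prod>b = 0..<r. g (\<phi> b) (p b))" for p
    unfolding lessThan_atLeast0 using assms by (intro prod_sum_PiE) auto
  then show ?thesis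
    unfolding det_mat_leibniz by (subst sum.swap) (simp add: sum_distrib_left)
qed

section \<open>Fekete's criterion\<close>

text \<open>Dividing each row by its first entry makes the first column constantly 1; subtracting
  from each row its predecessor then clears that column below the top, leaving a determinant of
  order \<open>r\<close>.\<close>

lemma minor_Suc_eq_det_differences:
  assumes nz: "\<And>i. i \<le> r \<Longrightarrow> A (rs i) 0 \<noteq> 0"
  shows "minor A (Suc r) rs id = (\<Prod>b\<le>r. A (rs b) 0) *
    det (mat r r (\<lambda>(b, a). A (rs (Suc b)) (Suc a) / A (rs (Suc b)) 0 - A (rs b) (Suc a) / A (rs b) 0))"
    (is "_ = _ * det ?D")
proof -
  define B where "B b a = A (rs b) a / A (rs b) 0" for b a
  define L where "L = mat (Suc r) (Suc r) (\<lambda>(b, c). if c \<le> b then A (rs b) 0 else 0)"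
  define C where "C = mat (Suc r) (Suc r) (\<lambda>(b, a). if b = 0 then B 0 a else B b a - B (b - 1) a)"
  have cL: "L \<in> carrier_mat (Suc r) (Suc r)" and cC: "C \<in> carrier_mat (Suc r) (Suc r)"
    by (auto simp: L_def C_def)
  have tel: "(\<Sum>c\<le>b. if c = 0 then B 0 a else B c a - B (c - 1) a) = B b a" for a b
    by (induction b) auto
  \<comment> \<open>Multiplication by the triangular \<open>L\<close> undoes the row operations:
    partial sums of the rows of \<open>C\<close> recover \<open>B\<close>, and the row factor
    restores \<open>A\<close>.\<close>
  have "mat (Suc r) (Suc r) (\<lambda>(b, a). A (rs b) (id a)) = L * C"
  proof (intro eq_matI)
    fix b a assume "b < dim_row (L * C)" "a < dim_col (L * C)"
    then have ba: "b < Suc r" "a < Suc r" using cL cC by auto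
    have "(L * C) $$ (b, a) =
        (\<Sum>c = 0..<Suc r. (if c \<le> b then A (rs b) 0 else 0) *
          (if c = 0 then B 0 a else B c a - B (c - 1) a))"
      using ba by (auto simp: L_def C_def scalar_prod_def simp del: sum.op_ivl_Suc intro!: sum.cong)
    also have "\<dots> = (\<Sum>c\<le>b. A (rs b) 0 * (if c = 0 then B 0 a else B c a - B (c - 1) a))"
      using ba by (intro sum.mono_neutral_cong_right) auto
    also have "\<dots> = A (rs b) 0 * B b a"
      by (simp only: sum_distrib_left[symmetric] tel)
    finally show "mat (Suc r) (Suc r) (\<lambda>(b, a). A (rs b) (id a)) $$ (b, a) = (L * C) $$ (b, a)"
      using ba nz[of b] by (simp add: B_def)
  qed (auto simp: L_def C_def)
  then have "minor A (Suc r) rs id = det L * det C"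
    unfolding minor_def using det_mult[OF cL cC] by simp
  moreover have "det L = (\<Prod>b\<le>r. A (rs b) 0)"
  proof -
    have "det L = prod_list (diag_mat L)"
      by (rule det_lower_triangular[OF _ cL]) (auto simp: L_def)
    also have "\<dots> = (\<Prod>b = 0..<Suc r. L $$ (b, b))"
      using cL by (simp add: prod_list_diag_prod del: prod.op_ivl_Suc)
    also have "\<dots> = (\<Prod>b\<le>r. A (rs b) 0)"
      by (intro prod.cong) (auto simp: L_def)
    finally show ?thesis .
  qed
  moreover have "det C = det ?D"
  proof -
    have "det C = (\<Sum>i<Suc r. C $$ (i, 0) * cofactor C i 0)"
      by (rule laplace_expansion_column[OF cC]) simp
    also have "\<dots> = (\<Sum>i<Suc r. if i = 0 then cofactor C 0 0 else 0)"
      using nz by (intro sum.cong) (auto simp: C_def B_def)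
    also have "\<dots> = cofactor C 0 0" by simp
    also have "\<dots> = det (mat_delete C 0 0)" by (simp add: cofactor_def)
    also have "mat_delete C 0 0 = ?D"
      by (intro eq_matI) (auto simp: mat_delete_def C_def B_def)
    finally show ?thesis .
  qed
  ultimately show ?thesis by simp
qed

text \<open>Induction on the order, with \<open>A\<close> arbitrary because the step replaces it by
  the matrix \<open>A'\<close> of differences of neighbouring normalised rows.\<close>

lemma minor_pos_if_consecutive_rows:
  fixes A :: "nat \<Rightarrow> nat \<Rightarrow> real"
  assumes "\<And>n s. n \<le> r \<Longrightarrow> minor A n (\<lambda>a. s + a) id > 0" and "strict_mono_on {..<r} rs"
  shows "minor A r rs id > 0"
  using assms
proof (induction r arbitrary: A rs)
  case 0
  then show ?case by (simp add: minor_def)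
next
  case (Suc r)
  have pos: "A p 0 > 0" for p
    using Suc.prems(1)[of 1 p] by (simp add: minor_def det_single)
  have nz: "A p 0 \<noteq> 0" for p
    using pos[of p] by simp
  define A' where "A' p a = A (Suc p) (Suc a) / A (Suc p) 0 - A p (Suc a) / A p 0" for p a
  \<comment> \<open>For consecutive rows the reduced determinant is itself a minor of
    \<open>A'\<close>, so the latter equals a minor of \<open>A\<close> of one order more, divided
    by positive entries.\<close>
  have A'_pos: "minor A' n (\<lambda>a. s + a) id > 0" if "n \<le> r" for n s
  proof -
    have "0 < (\<Prod>b\<le>n. A (s + b) 0) * minor A' n (\<lambda>a. s + a) id"
      using Suc.prems(1)[of "Suc n" s] that minor_Suc_eq_det_differences[of n A "\<lambda>a. s + a"]
      by (simp add: nz minor_def A'_def)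
    then show ?thesis
      using prod_pos[of "{..n}" "\<lambda>b. A (s + b) 0"] pos by (simp add: zero_less_mult_iff)
  qed
  define S where "S b = {rs b..<rs (Suc b)}" for b
  have lt: "rs b < rs (Suc b)" if "b < r" for b
    using Suc.prems(2) that by (auto simp: strict_mono_on_def)
  have tel: "A (rs (Suc b)) (Suc a) / A (rs (Suc b)) 0 - A (rs b) (Suc a) / A (rs b) 0
      = (\<Sum>i\<in>S b. A' i a)" if "b < r" for a b
    using lt[OF that] sum_Suc_diff'[of "rs b" "rs (Suc b)" "\<lambda>i. A i (Suc a) / A i 0"]
    by (simp add: S_def A'_def)
  have "minor A (Suc r) rs id = (\<Prod>b\<le>r. A (rs b) 0) *
      det (mat r r (\<lambda>(b, a). \<Sum>i\<in>S b. A' i a))"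
    unfolding minor_Suc_eq_det_differences[of r A rs, OF nz]
    by (intro arg_cong2[where f = "(*)"] arg_cong[where f = det] eq_matI) (auto simp: tel)
  also have "\<dots> = (\<Prod>b\<le>r. A (rs b) 0) * (\<Sum>\<phi>\<in>PiE {..<r} S. minor A' r \<phi> id)"
    by (subst det_sum_rows) (auto simp: S_def minor_def)
  also have "\<dots> > 0"
  proof (intro mult_pos_pos prod_pos sum_pos)
    show "finite (PiE {..<r} S)"
      by (intro finite_PiE) (auto simp: S_def)
    show "PiE {..<r} S \<noteq> {}"
      using lt by (auto simp: PiE_eq_empty_iff S_def)
    fix \<phi> assume \<phi>: "\<phi> \<in> PiE {..<r} S"
    \<comment> \<open>The half-open blocks \<open>S b\<close> are disjoint and follow one another,
      so every choice from them is increasing and the induction hypothesis covers each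
      summand.\<close>
    have "\<phi> a < \<phi> b" if "a < b" "b < r" for a b
    proof -
      have "\<phi> a < rs (Suc a)" "rs b \<le> \<phi> b"
        using \<phi> that by (auto simp: S_def PiE_iff)
      moreover have "rs (Suc a) \<le> rs b"
        using Suc.prems(2) that
        by (cases "Suc a = b") (auto simp: strict_mono_on_def intro!: less_imp_le)
      ultimately show ?thesis by linarith
    qed
    then show "minor A' r \<phi> id > 0"
      by (intro Suc.IH A'_pos) (auto simp: strict_mono_on_def)
  qed (auto simp: pos)
  finally show ?case .
qed

text \<open>The one-sided criterion is used twice: first to free the rows while the columns stay
  contiguous, then on the transpose, with the rows \<open>rs\<close> fixed, to free the
  columns.\<close>

lemma minor_pos_if_contiguous_minors_pos:
  fixes A :: "nat \<Rightarrow> nat \<Rightarrow> real"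
  assumes contig: "\<And>n s t. minor A n (\<lambda>a. s + a) (\<lambda>b. t + b) > 0"
    and rs: "strict_mono_on {..<r} rs" and cs: "strict_mono_on {..<r} cs"
  shows "minor A r rs cs > 0"
proof -
  \<comment> \<open>The one-sided criterion speaks of leading columns only, so any other column
    selection is absorbed into the matrix.\<close>
  have reindex: "minor (\<lambda>i j. B i (h j)) n us id = minor B n us h"
    for B :: "nat \<Rightarrow> nat \<Rightarrow> real" and h n us
    by (simp add: minor_def)
  have rows: "minor A n rs (\<lambda>b. t + b) > 0" if "n \<le> r" for n t
  proof -
    have "strict_mono_on {..<n} rs"
      using rs that by (auto simp: strict_mono_on_def)
    then show ?thesis
      using minor_pos_if_consecutive_rows[of n "\<lambda>i j. A i (t + j)" rs] contig
      by (simp add: reindex)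
  qed
  have "minor (\<lambda>k a. A (rs a) k) r cs id > 0"
  proof (rule minor_pos_if_consecutive_rows[OF _ cs])
    fix n s assume "n \<le> r"
    then show "minor (\<lambda>k a. A (rs a) k) n (\<lambda>a. s + a) id > 0"
      using rows[of n s] reindex[of "\<lambda>k i. A i k" rs n "\<lambda>b. s + b"] minor_transpose[of A n "\<lambda>b. s + b" rs]
      by simp
  qed
  then show ?thesis
    using reindex[of "\<lambda>k i. A i k" rs r cs] minor_transpose[of A r cs rs] by simp
qed

section \<open>Positive determinants from positive quadratic forms\<close>

text \<open>Homotopy to the identity matrix: the determinant never vanishes along the segment.\<close>
lemma det_pos_if_quadratic_form_pos:
  fixes A :: "nat \<Rightarrow> nat \<Rightarrow> real"
  assumes Q: "\<And>x. \<exists>i<n. x i \<noteq> 0 \<Longrightarrow> (\<Sum>i<n. \<Sum>j<n. x i * A i j * x j) > 0"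
  shows "det (mat n n (\<lambda>(i, j). A i j)) > 0"
proof (rule ccontr)
  assume neg: "\<not> ?thesis"
  define E where "E t i j = t * A i j + (1 - t) * of_bool (i = j)" for t :: real and i j
  define d where "d t = det (mat n n (\<lambda>(i, j). E t i j))" for t
  have d0: "d 0 = 1"
  proof -
    have "mat n n (\<lambda>(i, j). E 0 i j) = 1\<^sub>m n"
      by (intro eq_matI) (auto simp: E_def)
    then show ?thesis by (simp add: d_def)
  qed
  have d1: "d 1 \<le> 0"
    using neg by (simp add: d_def E_def)
  \<comment> \<open>The Leibniz formula exhibits \<open>d\<close> as a polynomial in
    \<open>t\<close>, hence as continuous.\<close>
  have d_eq: "d t = (\<Sum>p | p permutes {0..<n}. signof p * (\<Prod>i = 0..<n. E t i (p i)))" for t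
    by (simp add: d_def det_mat_leibniz)
  have "continuous_on {0..1} d"
    unfolding d_eq E_def by (intro continuous_intros)
  then obtain t where t: "0 \<le> t" "t \<le> 1" "d t = 0"
    using IVT2'[of d 1 0 0] d0 d1 by auto
  \<comment> \<open>A zero of \<open>d\<close> gives a kernel vector \<open>v\<close>. Its quadratic
    form under \<open>E t\<close> is then 0, yet it is a convex combination of two positive
    values.\<close>
  then obtain v where v: "v \<in> carrier_vec n" "v \<noteq> 0\<^sub>v n" "mat n n (\<lambda>(i, j). E t i j) *\<^sub>v v = 0\<^sub>v n"
    using det_0_iff_vec_prod_zero[of "mat n n (\<lambda>(i, j). E t i j)" n] by (auto simp: d_def)
  have row: "(\<Sum>j<n. E t i j * v $ j) = 0" if "i < n" for i
    using arg_cong[OF v(3), of "\<lambda>w. w $ i"] that v(1)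
    by (auto simp: scalar_prod_def lessThan_atLeast0 elim!: trans[rotated] intro!: sum.cong)
  have nz: "\<exists>i<n. v $ i \<noteq> 0"
    using v(1,2) by (metis carrier_vecD eq_vecI index_zero_vec)
  have "0 = (\<Sum>i<n. v $ i * (\<Sum>j<n. E t i j * v $ j))"
    by (simp add: row)
  also have "\<dots> = t * (\<Sum>i<n. \<Sum>j<n. v $ i * A i j * v $ j) + (1 - t) * (\<Sum>i<n. (v $ i)\<^sup>2)"
  proof -
    have "v $ i * (\<Sum>j<n. E t i j * v $ j) =
        t * (\<Sum>j<n. v $ i * A i j * v $ j) + (1 - t) * (v $ i)\<^sup>2" if "i < n" for i
    proof -
      have "(\<Sum>j<n. E t i j * v $ j) =
          t * (\<Sum>j<n. A i j * v $ j) + (1 - t) * (\<Sum>j<n. if i = j then v $ j else 0)"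
        unfolding sum_distrib_left sum.distrib[symmetric]
        by (intro sum.cong) (auto simp: E_def algebra_simps)
      also have "(\<Sum>j<n. if i = j then v $ j else 0) = v $ i"
        using that by simp
      finally have "v $ i * (\<Sum>j<n. E t i j * v $ j) =
          t * (v $ i * (\<Sum>j<n. A i j * v $ j)) + (1 - t) * (v $ i)\<^sup>2"
        by (simp only: power2_eq_square distrib_left mult_ac)
      then show ?thesis
        by (simp only: sum_distrib_left[of "v $ i" "\<lambda>j. A i j * v $ j"] mult.assoc)
    qed
    then show ?thesis
      by (subst (1 2) sum_distrib_left) (simp add: sum.distrib[symmetric])
  qed
  also have "\<dots> > 0"
  proof -
    have "(\<Sum>i<n. (v $ i)\<^sup>2) > 0"
      using nz by (auto intro: sum_pos2)
    then show ?thesis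
      using Q[of "\<lambda>i. v $ i", OF nz] t
      by (cases "t = 0") (auto intro!: add_pos_nonneg)
  qed
  finally show False by simp
qed

section \<open>Hankel matrices of factorials\<close>

text \<open>This is Vandermonde's convolution for \<open>(s + i + j) choose j\<close> times
  \<open>fact (s + i) * fact j\<close>, with the summands rewritten symmetrically in
  \<open>i\<close> and \<open>j\<close>. The factor depending on \<open>i\<close> and
  \<open>k\<close> vanishes for \<open>k > i\<close>.\<close>

lemma fact_add_eq_gram:
  assumes "i < n" "j < n"
  shows "(fact (s + i + j) :: real) = (\<Sum>k<n. fact (s + k) / fact k *
    (fact i * real ((s + i) choose (s + k))) * (fact j * real ((s + j) choose (s + k))))"
proof -
  have summand: "fact (s + k) / fact k * (fact i * real ((s + i) choose (s + k))) =
      fact (s + i) * real (i choose k)" for k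
  proof (cases "k \<le> i")
    case True
    then show ?thesis by (simp add: binomial_fact field_simps)
  qed (simp add: binomial_eq_0)
  have "real ((s + i + j) choose j) = (\<Sum>k\<le>j. real (i choose k) * real ((s + j) choose (j - k)))"
    using vandermonde[of i "s + j" j]
    by (simp add: add_ac flip: of_nat_mult of_nat_sum)
  also have "\<dots> = (\<Sum>k\<le>j. real (i choose k) * real ((s + j) choose (s + k)))"
    by (intro sum.cong) (auto simp: binomial_symmetric[of "j - _" "s + j"])
  also have "\<dots> = (\<Sum>k<n. real (i choose k) * real ((s + j) choose (s + k)))"
    using assms by (intro sum.mono_neutral_left) auto
  finally have "fact (s + i) * fact j * real ((s + i + j) choose j) =
      (\<Sum>k<n. fact (s + k) / fact k * (fact i * real ((s + i) choose (s + k))) *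
        (fact j * real ((s + j) choose (s + k))))"
    by (simp only: summand) (simp add: sum_distrib_left mult_ac)
  then show ?thesis
    by (simp add: binomial_fact)
qed

text \<open>An explicit Schur product argument: inserting both Gram factorizations turns the
  quadratic form into a sum over \<open>k\<close> and \<open>l\<close> of positive weights times
  squares.\<close>

lemma det_hankel_fact_fact_pos:
  "det (mat n n (\<lambda>(i, j). fact (s + i + j) * fact (t + i + j) :: real)) > 0"
proof (rule det_pos_if_quadratic_form_pos)
  fix x :: "nat \<Rightarrow> real"
  assume nz: "\<exists>i<n. x i \<noteq> 0"
  define u where "u s i k = fact i * real ((s + i) choose (s + k))" for s i k :: nat
  define w where "w s k = (fact (s + k) / fact k :: real)" for s k :: nat
  have w_pos: "w s k > 0" for s k
    by (simp add: w_def)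
  have "(\<Sum>i<n. \<Sum>j<n. x i * (fact (s + i + j) * fact (t + i + j)) * x j) =
      (\<Sum>i<n. \<Sum>j<n. \<Sum>k<n. \<Sum>l<n. w s k * w t l * ((x i * u s i k * u t i l) * (x j * u s j k * u t j l)))"
  proof (intro sum.cong refl)
    fix i j assume "i \<in> {..<n}" "j \<in> {..<n}"
    then have "(fact (s + i + j) :: real) = (\<Sum>k<n. w s k * u s i k * u s j k)"
      "(fact (t + i + j) :: real) = (\<Sum>l<n. w t l * u t i l * u t j l)"
      unfolding w_def u_def by (intro fact_add_eq_gram; simp)+
    then have "x i * (fact (s + i + j) * fact (t + i + j)) * x j =
        (\<Sum>k<n. \<Sum>l<n. x i * ((w s k * u s i k * u s j k) * (w t l * u t i l * u t j l)) * x j)"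
      by (simp only: sum_product) (simp only: sum_distrib_left sum_distrib_right)
    then show "x i * (fact (s + i + j) * fact (t + i + j)) * x j =
        (\<Sum>k<n. \<Sum>l<n. w s k * w t l * ((x i * u s i k * u t i l) * (x j * u s j k * u t j l)))"
      by (simp only: mult_ac)
  qed
  \<comment> \<open>With \<open>k\<close> and \<open>l\<close> outermost, the inner double sum over
    \<open>i\<close> and \<open>j\<close> factors into a square.\<close>
  also have "\<dots> = (\<Sum>k<n. \<Sum>l<n. \<Sum>i<n. \<Sum>j<n. w s k * w t l * ((x i * u s i k * u t i l) * (x j * u s j k * u t j l)))"
    (is "?lhs = ?rhs")
  proof -
    have "?lhs = (\<Sum>i<n. \<Sum>k<n. \<Sum>j<n. \<Sum>l<n. w s k * w t l * ((x i * u s i k * u t i l) * (x j * u s j k * u t j l)))"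
      by (rule sum.cong[OF refl], rule sum.swap)
    also have "\<dots> = (\<Sum>k<n. \<Sum>i<n. \<Sum>j<n. \<Sum>l<n. w s k * w t l * ((x i * u s i k * u t i l) * (x j * u s j k * u t j l)))"
      by (rule sum.swap)
    also have "\<dots> = (\<Sum>k<n. \<Sum>i<n. \<Sum>l<n. \<Sum>j<n. w s k * w t l * ((x i * u s i k * u t i l) * (x j * u s j k * u t j l)))"
      by (rule sum.cong[OF refl], rule sum.cong[OF refl], rule sum.swap)
    also have "\<dots> = ?rhs"
      by (rule sum.cong[OF refl], rule sum.swap)
    finally show ?thesis .
  qed
  also have "\<dots> = (\<Sum>k<n. \<Sum>l<n. w s k * w t l * (\<Sum>i<n. x i * u s i k * u t i l)\<^sup>2)"
    by (simp only: power2_eq_square sum_product) (simp only: sum_distrib_left)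
  also have "\<dots> > 0"
  proof -
    \<comment> \<open>One nonzero square suffices. For the last index \<open>k\<close> with
      \<open>x k \<noteq> 0\<close> and for \<open>l = 0\<close>, terms with \<open>i < k\<close>
      vanish by triangularity and those with \<open>i > k\<close> because \<open>x i = 0\<close>;
      the term \<open>i = k\<close> is nonzero.\<close>
    define k where "k = Max {i. i < n \<and> x i \<noteq> 0}"
    have "k \<in> {i. i < n \<and> x i \<noteq> 0}"
      unfolding k_def using nz by (intro Max_in) auto
    then have k: "k < n" "x k \<noteq> 0" by auto
    have above: "x i = 0" if "k < i" "i < n" for i
      using that Max_ge[of "{i. i < n \<and> x i \<noteq> 0}" i]
      unfolding k_def[symmetric] by (cases "x i = 0") auto
    have "(\<Sum>i<n. x i * u s i k * u t i 0) = (\<Sum>i\<in>{k}. x i * u s i k * u t i 0)"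
    proof (intro sum.mono_neutral_right ballI)
      fix i assume "i \<in> {..<n} - {k}"
      then show "x i * u s i k * u t i 0 = 0"
        using above[of i] by (cases "i < k") (auto simp: u_def)
    qed (use k in auto)
    then have "(\<Sum>i<n. x i * u s i k * u t i 0) \<noteq> 0"
      using k by (simp add: u_def)
    then have "w s k * w t 0 * (\<Sum>i<n. x i * u s i k * u t i 0)\<^sup>2 > 0"
      using w_pos by simp
    then have "(\<Sum>l<n. w s k * w t l * (\<Sum>i<n. x i * u s i k * u t i l)\<^sup>2) > 0"
      using k w_pos by (intro sum_pos2[where i = 0]) (auto simp: less_imp_le)
    then show ?thesis
      by (rule sum_pos2[where i = k, rotated 2]) (use k w_pos in \<open>auto simp: less_imp_le intro!: sum_nonneg\<close>)
  qed
  finally show "(\<Sum>i<n. \<Sum>j<n. x i * (fact (s + i + j) * fact (t + i + j)) * x j) > 0" .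
qed

section \<open>Reduction of the given matrix to the Hankel case\<close>

text \<open>The denominator \<open>n + k + 2\<close> cancels the top factor of
  \<open>fact (n + k + 2)\<close>. The remaining factors depend on the row alone, on the column
  alone, or on \<open>n - m + k\<close>.\<close>

lemma NA_eq_scaled_hankel:
  assumes "n \<ge> m"
  shows "NA m (n + k) k = (real (m + 1) / (fact (n + 1) * fact (n - m))) *
    (1 / (fact (k + 1) * fact k)) * (fact (n - m + k) * fact (m + 1 + (n - m) + k))"
proof -
  have 1: "real ((n + k + 2) choose (k + 1)) = fact (n + k + 2) / (fact (k + 1) * fact (n + 1))"
    by (subst binomial_fact) auto
  have 2: "real ((n + k - m) choose k) = fact (n - m + k) / (fact k * fact (n - m))"
    using assms by (subst binomial_fact) (auto simp: algebra_simps)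
  have 3: "(fact (n + k + 2) :: real) = real (n + k + 2) * fact (m + 1 + (n - m) + k)"
    using assms by (simp add: numeral_2_eq_2)
  show ?thesis
    unfolding NA_def 1 2 3 by (simp add: mult_ac del: fact_Suc of_nat_Suc of_nat_add)
qed

theorem theorem3p3:
  fixes m :: nat
  shows "strictly_totally_positive {m..} UNIV (\<lambda>n k. NA m (n + k) k)"
  unfolding strictly_totally_positive_def
proof (intro allI impI)
  fix r :: nat and rs cs :: "nat \<Rightarrow> nat"
  assume rs: "strict_mono_on {..<r} rs" "rs ` {..<r} \<subseteq> {m..}" and cs: "strict_mono_on {..<r} cs"
  define H :: "nat \<Rightarrow> nat \<Rightarrow> real" where "H p k = fact (p + k) * fact (m + 1 + p + k)" for p k
  define x where "x n = real (m + 1) / (fact (n + 1) * fact (n - m))" for n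
  define y where "y k = (1 / (fact (k + 1) * fact k) :: real)" for k
  \<comment> \<open>A contiguous block of \<open>H\<close> starting at \<open>(s, t)\<close> is
    again a Hankel matrix of the same kind, with shifts \<open>s + t\<close> and
    \<open>m + 1 + s + t\<close>.\<close>
  have "minor H n (\<lambda>a. s + a) (\<lambda>b. t + b) > 0" for n s t
    using det_hankel_fact_fact_pos[of n "s + t" "m + 1 + s + t"]
    by (simp add: minor_def H_def add_ac del: fact_Suc)
  moreover have "strict_mono_on {..<r} (\<lambda>a. rs a - m)"
    using rs by (auto simp: strict_mono_on_def intro!: diff_less_mono)
  ultimately have "minor H r (\<lambda>a. rs a - m) cs > 0"
    using cs by (rule minor_pos_if_contiguous_minors_pos)
  \<comment> \<open>The factorization holds for rows \<open>n \<ge> m\<close>, so it is applied to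
    the selected entries only.\<close>
  moreover have "minor (\<lambda>n k. NA m (n + k) k) r rs cs =
      minor (\<lambda>n k. x n * y k * H (n - m) k) r rs cs"
    unfolding minor_def
  proof (intro arg_cong[where f = det] eq_matI)
    fix i j assume "i < dim_row (mat r r (\<lambda>(a, b). x (rs a) * y (cs b) * H (rs a - m) (cs b)))"
      "j < dim_col (mat r r (\<lambda>(a, b). x (rs a) * y (cs b) * H (rs a - m) (cs b)))"
    then show "mat r r (\<lambda>(a, b). NA m (rs a + cs b) (cs b)) $$ (i, j) =
        mat r r (\<lambda>(a, b). x (rs a) * y (cs b) * H (rs a - m) (cs b)) $$ (i, j)"
      using rs(2) by (auto simp: NA_eq_scaled_hankel x_def y_def H_def simp del: fact_Suc)
  qed auto
  moreover have "\<dots> = (\<Prod>a<r. x (rs a)) * (\<Prod>b<r. y (cs b)) * minor H r (\<lambda>a. rs a - m) cs"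
    by (subst minor_scale) (simp add: minor_def)
  moreover have "(\<Prod>a<r. x (rs a)) > 0" "(\<Prod>b<r. y (cs b)) > 0"
    by (auto intro!: prod_pos simp: x_def y_def)
  ultimately show "minor (\<lambda>n k. NA m (n + k) k) r rs cs > 0"
    by simp
qed

end
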